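(* Let $U\subseteq\mathcal{R}$ and let $\theta(\mathbf{x},t)\in\mathbb{R}^{n\times n}$ be an invertible metric function such that the generalized reduced Jacobian satisfies $\mu_2(F_r)<0$ for all $\mathbf{x}\in U$ and all $t$. Then for every $\epsilon>0$ there exist matrices $Q\in\mathbb{R}^{m\times m}$, $R\in\mathbb{R}^{m\times n}$ and an invertible $\rho\in\mathbb{R}^{m\times m}$ (possibly depending on $\mathbf{x}$ and $t$) such that the generalized unreduced Jacobian $F$ determined by $\theta,Q,R,\rho$ satisfies, for all $\mathbf{x}\in U$ and all $t$, $$\mu_2(F)\le\frac{\mu_2(F_r)}{1+\epsilon}.$$
   Context: Consider the differential-algebraic (DAE) system $\dot{\mathbf{x}}=\mathbf{f}(\mathbf{x},\mathbf{y})$, $0=\mathbf{g}(\mathbf{x},\mathbf{y})$ with $\mathbf{x}\in\mathbb{R}^n$, $\mathbf{y}\in\mathbb{R}^m$, and $\mathbf{f},\mathbf{g}$ continuously differentiable with values in $\mathbb{R}^n$ and $\mathbb{R}^m$. A solution branch $\mathbf{y}=\mathbf{Y}(\mathbf{x})$ of $\mathbf{g}(\mathbf{x},\mathbf{Y}(\mathbf{x}))=0$ is fixed, and all analysis is restricted to the domain $\mathcal{R}$ of points $\mathbf{x}$ where this branch exists and $\det\left(\partial\mathbf{g}/\partial\mathbf{y}\right)|_{\mathbf{y}=\mathbf{Y}(\mathbf{x})}\neq0$. The reduced system is $\dot{\mathbf{x}}=\mathbf{f}(\mathbf{x},\mathbf{Y}(\mathbf{x}))$. For $\mathbf{x}\in\mathcal{R}$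 put $A=\partial\mathbf{f}/\partial\mathbf{x}$, $B=\partial\mathbf{f}/\partial\mathbf{y}$, $C=\partial\mathbf{g}/\partial\mathbf{x}$, $D=\partial\mathbf{g}/\partial\mathbf{y}$, all evaluated at $(\mathbf{x},\mathbf{Y}(\mathbf{x}))$; thus $D$ is invertible. A metric function is a differentiable matrix-valued function $\theta(\mathbf{x},t)\in\mathbb{R}^{n\times n}$ with invertible values; $\dot\theta=\frac{\partial\theta}{\partial t}+\sum_{i=1}^n\frac{\partial\theta}{\partial x_i}\,f_i(\mathbf{x},\mathbf{Y}(\mathbf{x}))$ is its derivative along trajectories. The generalized reduced Jacobian is $$F_r=\dot\theta\theta^{-1}+\theta(A-BD^{-1}C)\theta^{-1}\in\mathbb{R}^{n\times n}.$$ Given auxiliary matrices $Q\in\mathbb{R}^{m\times m}$, $R\in\mathbb{R}^{m\times n}$ and an invertible metric $\rho\in\mathbb{R}^{m\times m}$ for the variable $\mathbf{y}$, the generalized unreduced Jacobian (the Jacobian of the extended system) is $$F=\begin{bmatrix}F_r+\theta R^TC\theta^{-1} & \theta R^TD\rho^{-1}\\ Q^TC\theta^{-1} & Q^TD\rho^{-1}\end{bmatrix}\in\mathbb{R}^{(n+m)\times(n+m)}.$$ For a square real matrix $M$, the matrix measure is $\mu_2(M)=\lim_{h\to0^+}\frac1h\left(\|\mathbb{1}+hM\|_2-1\right)$ with the operator norm induced by the Euclidean norm; equivalently $\mu_2(M)$ is the largest eigenvalue of $(M+M^T)/2$. *)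

theory Defs
  imports "HOL-Analysis.Analysis"
begin

definition continuously_differentiable ::
    "('a::real_normed_vector \<Rightarrow> 'b::real_normed_vector) \<Rightarrow> bool" where
  "continuously_differentiable h \<longleftrightarrow>
     (\<exists>h'. (\<forall>z. (h has_derivative blinfun_apply (h' z)) (at z)) \<and> continuous_on UNIV h')"

text \<open>The norm on \<^typ>\<open>real^'k\<close> is the Euclidean one, so \<^const>\<open>onorm\<close> of the induced
  linear map is the spectral norm of the matrix. \<^const>\<open>Lim\<close> is a definite description;
  the limit exists for every matrix by the lemma \<open>matrix_measure_tendsto\<close> below.\<close>

definition matrix_measure :: "real^'k^'k \<Rightarrow> real" where
  "matrix_measure M =
     Lim (at_right 0) (\<lambda>h. (onorm (\<lambda>v. (mat 1 + h *\<^sub>R M) *v v) - 1) / h)"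

lemma matrix_measure_tendsto:
  fixes M :: "real^'k^'k"
  shows "((\<lambda>h. (onorm (\<lambda>v. (mat 1 + h *\<^sub>R M) *v v) - 1) / h) \<longlongrightarrow> matrix_measure M) (at_right 0)"
proof -
  define N where "N h = onorm (\<lambda>v. (mat 1 + h *\<^sub>R M) *v v)" for h :: real
  define q where "q h = (N h - 1) / h" for h :: real
  have bl: "bounded_linear (\<lambda>v. P *v v)" for P :: "real^'k^'k"
    by (rule matrix_vector_mul_bounded_linear)
  have id1: "onorm (\<lambda>v::real^'k. v) = 1"
    by (rule onorm_id)
  have mono: "q h \<le> q k" if "0 < h" "h \<le> k" for h k
  proof -
    have eq: "(\<lambda>v. (mat 1 + h *\<^sub>R M) *v v) =
        (\<lambda>v. (1 - h/k) *\<^sub>R v + (h/k) *\<^sub>R ((mat 1 + k *\<^sub>R M) *v v))"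
      using that by (auto simp: fun_eq_iff matrix_vector_mult_add_rdistrib
          scaleR_matrix_vector_assoc[symmetric] algebra_simps)
    have "N h \<le> onorm (\<lambda>v::real^'k. (1 - h/k) *\<^sub>R v) +
        onorm (\<lambda>v. (h/k) *\<^sub>R ((mat 1 + k *\<^sub>R M) *v v))"
      unfolding N_def eq
      by (intro onorm_triangle bounded_linear_const_scaleR bl bounded_linear_ident)
    also have "\<dots> = (1 - h/k) + (h/k) * N k"
      using that by (simp add: onorm_scaleR[OF bl] onorm_scaleR[OF bounded_linear_ident] id1 N_def)
    finally have "N h - 1 \<le> (h/k) * (N k - 1)" by (simp add: algebra_simps)
    then have "(N h - 1) / h \<le> (h/k) * (N k - 1) / h"
      using that by (intro divide_right_mono) auto
    then show ?thesis using that by (simp add: q_def)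
  qed
  have lower: "- onorm (\<lambda>v. M *v v) \<le> q h" if "0 < h" for h
  proof -
    have eq: "(\<lambda>v::real^'k. v) = (\<lambda>v. (mat 1 + h *\<^sub>R M) *v v + (- h) *\<^sub>R (M *v v))"
      by (auto simp: fun_eq_iff matrix_vector_mult_add_rdistrib scaleR_matrix_vector_assoc[symmetric])
    have "1 = onorm (\<lambda>v. (mat 1 + h *\<^sub>R M) *v v + (- h) *\<^sub>R (M *v v))"
      by (simp only: eq[symmetric] id1)
    also have "\<dots> \<le> N h + onorm (\<lambda>v. (- h) *\<^sub>R (M *v v))"
      unfolding N_def by (intro onorm_triangle bounded_linear_const_scaleR bl)
    also have "\<dots> = N h + h * onorm (\<lambda>v. M *v v)"
      using that by (simp add: onorm_scaleR[OF bl] del: scaleR_minus_left)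
    finally show ?thesis using that by (simp add: q_def field_simps)
  qed
  define l where "l = Inf (q ` {0<..})"
  have bdd: "bdd_below (q ` {0<..})"
    using lower by (intro bdd_belowI2) auto
  have "(q \<longlongrightarrow> l) (at_right 0)"
  proof (rule order_tendstoI)
    fix a assume a: "a < l"
    have "l \<le> q h" if "h > 0" for h
      unfolding l_def using that by (intro cInf_lower bdd) auto
    then have "a < q h" if "h > 0" for h
      using a that by (meson less_le_trans)
    moreover have "\<forall>\<^sub>F h in at_right 0. (0::real) < h"
      by (simp add: eventually_at_right_less)
    ultimately show "\<forall>\<^sub>F h in at_right 0. a < q h"
      by (auto elim: eventually_mono)
  next
    fix a assume "l < a"
    then obtain k where k: "k > 0" "q k < a"
      unfolding l_def by (subst (asm) cInf_less_iff[OF _ bdd]) auto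
    have "q h < a" if "0 < h" "h < k" for h
      using mono[of h k] that k by linarith
    then show "\<forall>\<^sub>F h in at_right 0. q h < a"
      unfolding eventually_at_right_field using k(1) by blast
  qed
  moreover from this have "Lim (at_right 0) q = l"
    by (intro tendsto_Lim) (auto simp: trivial_limit_at_right_real)
  ultimately show ?thesis
    by (simp add: matrix_measure_def q_def[abs_def] N_def[abs_def])
qed

context
  fixes f :: "real^'n \<Rightarrow> real^'m \<Rightarrow> real^'n"
    and g :: "real^'n \<Rightarrow> real^'m \<Rightarrow> real^'m"
    and Y :: "real^'n \<Rightarrow> real^'m"
begin

definition A_mat :: "real^'n \<Rightarrow> real^'n^'n" where
  "A_mat x = jacobian (\<lambda>x'. f x' (Y x)) (at x)"

definition B_mat :: "real^'n \<Rightarrow> real^'m^'n" where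
  "B_mat x = jacobian (\<lambda>y. f x y) (at (Y x))"

definition C_mat :: "real^'n \<Rightarrow> real^'n^'m" where
  "C_mat x = jacobian (\<lambda>x'. g x' (Y x)) (at x)"

definition D_mat :: "real^'n \<Rightarrow> real^'m^'m" where
  "D_mat x = jacobian (\<lambda>y. g x y) (at (Y x))"

text \<open>\<open>S\<close> is the set on which the branch \<open>Y\<close> exists; the values of \<open>Y\<close> off \<open>S\<close> are irrelevant.\<close>

definition regular_domain :: "(real^'n) set \<Rightarrow> (real^'n) set" where
  "regular_domain S = {x \<in> S. det (D_mat x) \<noteq> 0}"

definition trajectory_deriv ::
    "(real^'n \<Rightarrow> real \<Rightarrow> real^'n^'n) \<Rightarrow> real^'n \<Rightarrow> real \<Rightarrow> real^'n^'n" where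
  "trajectory_deriv \<theta> x t =
     vector_derivative (\<lambda>s. \<theta> x s) (at t) +
     (\<Sum>i\<in>UNIV. (f x (Y x) $ i) *\<^sub>R frechet_derivative (\<lambda>x'. \<theta> x' t) (at x) (axis i 1))"

definition reduced_jacobian ::
    "(real^'n \<Rightarrow> real \<Rightarrow> real^'n^'n) \<Rightarrow> real^'n \<Rightarrow> real \<Rightarrow> real^'n^'n" where
  "reduced_jacobian \<theta> x t =
     trajectory_deriv \<theta> x t ** matrix_inv (\<theta> x t) +
     \<theta> x t ** (A_mat x - B_mat x ** matrix_inv (D_mat x) ** C_mat x) ** matrix_inv (\<theta> x t)"

end

definition metric_function_on ::
    "(real^'n) set \<Rightarrow> (real^'n \<Rightarrow> real \<Rightarrow> real^'k^'k) \<Rightarrow> bool" where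
  "metric_function_on X \<theta> \<longleftrightarrow>
     (\<forall>x\<in>X. \<forall>t. (\<lambda>(x, t). \<theta> x t) differentiable (at (x, t)) \<and> invertible (\<theta> x t))"

definition block_matrix ::
    "real^'n^'n \<Rightarrow> real^'m^'n \<Rightarrow> real^'n^'m \<Rightarrow> real^'m^'m \<Rightarrow> real^('n + 'm)^('n + 'm)" where
  "block_matrix M11 M12 M21 M22 = (\<chi> i j.
     case i of
       Inl a \<Rightarrow> (case j of Inl b \<Rightarrow> M11 $ a $ b | Inr b \<Rightarrow> M12 $ a $ b)
     | Inr a \<Rightarrow> (case j of Inl b \<Rightarrow> M21 $ a $ b | Inr b \<Rightarrow> M22 $ a $ b))"

text \<open>\<open>Q\<close>, \<open>R\<close> and \<open>\<rho>\<close> are the values of the auxiliary matrices at the point \<open>(x, t)\<close>.\<close>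

definition unreduced_jacobian ::
    "(real^'n \<Rightarrow> real^'m \<Rightarrow> real^'n) \<Rightarrow> (real^'n \<Rightarrow> real^'m \<Rightarrow> real^'m) \<Rightarrow>
     (real^'n \<Rightarrow> real^'m) \<Rightarrow> (real^'n \<Rightarrow> real \<Rightarrow> real^'n^'n) \<Rightarrow>
     real^'m^'m \<Rightarrow> real^'n^'m \<Rightarrow> real^'m^'m \<Rightarrow>
     real^'n \<Rightarrow> real \<Rightarrow> real^('n + 'm)^('n + 'm)" where
  "unreduced_jacobian f g Y \<theta> Q R \<rho> x t =
     block_matrix
       (reduced_jacobian f g Y \<theta> x t +
          \<theta> x t ** transpose R ** C_mat g Y x ** matrix_inv (\<theta> x t))
       (\<theta> x t ** transpose R ** D_mat g Y x ** matrix_inv \<rho>)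
       (transpose Q ** C_mat g Y x ** matrix_inv (\<theta> x t))
       (transpose Q ** D_mat g Y x ** matrix_inv \<rho>)"

end

theory Submission
  imports Defs
begin

text \<open>Take \<open>R = 0\<close>, \<open>Q = -1\<close> and \<open>\<rho> = s D\<close>. With \<open>E = -C \<theta>\<^sup>-\<^sup>1\<close> the unreduced
  Jacobian is then lower block triangular, with blocks \<open>F\<^sub>r\<close>, \<open>0\<close>, \<open>E\<close> and \<open>-(1/s) 1\<close>. By Young's
  inequality the cross term \<open>w \<bullet> E u\<close> of its quadratic form is at most \<open>d |u|\<^sup>2 + |E|\<^sup>2/(4d) |w|\<^sup>2\<close>,
  where \<open>d = \<mu>(F\<^sub>r)/(1 + \<epsilon>) - \<mu>(F\<^sub>r) > 0\<close> is the slack in the \<open>u\<close>-part; the \<open>w\<close>-part is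
  dominated by \<open>-(1/s) |w|\<^sup>2\<close> for small \<open>s\<close>.\<close>

text \<open>The bound already holds for every difference quotient with \<open>h > 0\<close>, by
  Cauchy-Schwarz applied to \<open>v\<close> and \<open>(mat 1 + h *\<^sub>R M) *v v\<close>, and it
  survives the limit. Together with the converse estimate \<open>matrix_measure_le\<close> it lets
  the measure be handled through the quadratic form of \<open>M\<close> alone, without
  eigenvalues.\<close>

lemma inner_le_matrix_measure:
  fixes M :: "real^'k^'k"
  shows "v \<bullet> (M *v v) \<le> matrix_measure M * (v \<bullet> v)"
proof -
  define N where "N h = onorm (\<lambda>v. (mat 1 + h *\<^sub>R M) *v v)" for h :: real
  have "((\<lambda>h. (N h - 1) / h * (v \<bullet> v)) \<longlongrightarrow> matrix_measure M * (v \<bullet> v)) (at_right 0)"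
    unfolding N_def by (intro tendsto_mult_right matrix_measure_tendsto)
  moreover have "v \<bullet> (M *v v) \<le> (N h - 1) / h * (v \<bullet> v)" if "h > 0" for h
  proof -
    have "v \<bullet> v + h * (v \<bullet> (M *v v)) = v \<bullet> ((mat 1 + h *\<^sub>R M) *v v)"
      by (simp add: matrix_vector_mult_add_rdistrib scaleR_matrix_vector_assoc[symmetric]
          inner_add_right)
    also have "\<dots> \<le> norm v * norm ((mat 1 + h *\<^sub>R M) *v v)"
      by (rule norm_cauchy_schwarz)
    also have "\<dots> \<le> norm v * (N h * norm v)"
      unfolding N_def by (intro mult_left_mono onorm matrix_vector_mul_bounded_linear) auto
    also have "\<dots> = N h * (v \<bullet> v)"
      by (simp add: dot_square_norm power2_eq_square)
    finally have "h * (v \<bullet> (M *v v)) \<le> (N h - 1) * (v \<bullet> v)"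
      by (simp add: algebra_simps)
    then show ?thesis using that by (simp add: field_simps)
  qed
  then have "\<forall>\<^sub>F h in at_right 0. v \<bullet> (M *v v) \<le> (N h - 1) / h * (v \<bullet> v)"
    using eventually_at_right_less[of "0::real"] by (auto elim: eventually_mono)
  ultimately show ?thesis
    by (intro tendsto_lowerbound) (auto simp: trivial_limit_at_right_real)
qed

text \<open>In the square of the norm of \<open>v + h *\<^sub>R (M *v v)\<close> the hypothesis
  controls the term linear in \<open>h\<close>; the remaining term is of order \<open>h^2\<close>
  and still vanishes after division by \<open>h\<close>.\<close>

lemma matrix_measure_le:
  fixes M :: "real^'k^'k"
  assumes le: "\<And>v. v \<bullet> (M *v v) \<le> b * (v \<bullet> v)"
  shows "matrix_measure M \<le> b"
proof -
  define K where "K = onorm (\<lambda>v. M *v v)"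
  have "(onorm (\<lambda>v. (mat 1 + h *\<^sub>R M) *v v) - 1) / h \<le> b + h * (K\<^sup>2 / 2)" if h: "h > 0" for h
  proof -
    \<comment> \<open>Chosen so that \<open>1 + 2 * y\<close> bounds the squared operator norm.
      Since \<open>1 + 2 * y\<close> is at most the square of \<open>1 + y\<close>, the norm itself
      is bounded by \<open>1 + y\<close> with no square root taken, and \<open>y / h\<close> is the
      desired right-hand side.\<close>
    define y where "y = h * b + h\<^sup>2 * K\<^sup>2 / 2"
    have sq: "(norm ((mat 1 + h *\<^sub>R M) *v v))\<^sup>2 \<le> (1 + 2 * y) * (norm v)\<^sup>2" for v
    proof -
      have "(norm (M *v v))\<^sup>2 \<le> (K * norm v)\<^sup>2"
        unfolding K_def by (intro power_mono onorm matrix_vector_mul_bounded_linear) auto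
      then have "h\<^sup>2 * (norm (M *v v))\<^sup>2 \<le> h\<^sup>2 * (K\<^sup>2 * (norm v)\<^sup>2)"
        by (intro mult_left_mono) (auto simp: power_mult_distrib)
      moreover have "2 * h * (v \<bullet> (M *v v)) \<le> 2 * h * (b * (norm v)\<^sup>2)"
        using le[of v] h by (intro mult_left_mono) (auto simp: dot_square_norm)
      moreover have "(mat 1 + h *\<^sub>R M) *v v = v + h *\<^sub>R (M *v v)"
        by (simp add: matrix_vector_mult_add_rdistrib scaleR_matrix_vector_assoc[symmetric])
      then have "(norm ((mat 1 + h *\<^sub>R M) *v v))\<^sup>2 =
          (norm v)\<^sup>2 + 2 * h * (v \<bullet> (M *v v)) + h\<^sup>2 * (norm (M *v v))\<^sup>2"
        unfolding power2_norm_eq_inner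
        by (simp add: inner_add_left inner_add_right inner_commute power2_eq_square)
      ultimately show ?thesis by (simp add: y_def algebra_simps)
    qed
    \<comment> \<open>As \<open>b\<close> may be negative, so may \<open>y\<close>; testing
      \<open>sq\<close> on a unit vector shows that \<open>1 + y\<close> is nevertheless
      nonnegative, which is required to compare squares.\<close>
    have "0 \<le> 1 + 2 * y"
      using order_trans[OF zero_le_power2 sq[of "axis undefined 1"]] by (simp add: norm_axis_1)
    then have y: "0 \<le> 1 + y" by simp
    have "norm ((mat 1 + h *\<^sub>R M) *v v) \<le> (1 + y) * norm v" for v
    proof (rule power2_le_imp_le)
      have "(1 + 2 * y) * (norm v)\<^sup>2 \<le> (1 + y)\<^sup>2 * (norm v)\<^sup>2"
        by (intro mult_right_mono) (auto simp: power2_eq_square algebra_simps)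
      then show "(norm ((mat 1 + h *\<^sub>R M) *v v))\<^sup>2 \<le> ((1 + y) * norm v)\<^sup>2"
        using sq[of v] by (simp add: power_mult_distrib)
    qed (use y in simp)
    then have "onorm (\<lambda>v. (mat 1 + h *\<^sub>R M) *v v) \<le> 1 + y"
      by (intro onorm_le) auto
    then show ?thesis using h by (simp add: y_def field_simps power2_eq_square)
  qed
  then have ev: "\<forall>\<^sub>F h in at_right 0. (onorm (\<lambda>v. (mat 1 + h *\<^sub>R M) *v v) - 1) / h \<le> b + h * (K\<^sup>2 / 2)"
    using eventually_at_right_less[of "0::real"] by (auto elim: eventually_mono)
  have "((\<lambda>h. b + h * (K\<^sup>2 / 2)) \<longlongrightarrow> b + 0 * (K\<^sup>2 / 2)) (at_right 0)"
    by (intro tendsto_intros)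
  then show ?thesis
    using tendsto_le[OF _ _ matrix_measure_tendsto ev] by (simp add: trivial_limit_at_right_real)
qed

lemma sum_UNIV_Plus:
  fixes h :: "'a::finite + 'b::finite \<Rightarrow> 'c::comm_monoid_add"
  shows "(\<Sum>i\<in>UNIV. h i) = (\<Sum>i\<in>UNIV. h (Inl i)) + (\<Sum>i\<in>UNIV. h (Inr i))"
  using sum.Plus[of UNIV UNIV h] by (simp add: comp_def)

lemma inner_Plus:
  fixes v w :: "real^('n::finite + 'm::finite)"
  shows "v \<bullet> w = (\<chi> i. v $ Inl i) \<bullet> (\<chi> i. w $ Inl i) + (\<chi> i. v $ Inr i) \<bullet> (\<chi> i. w $ Inr i)"
  by (simp add: inner_vec_def sum_UNIV_Plus)

lemma block_matrix_vector_mult: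
  fixes v :: "real^('n::finite + 'm::finite)"
  defines "u \<equiv> \<chi> i. v $ Inl i" and "w \<equiv> \<chi> i. v $ Inr i"
  shows "(\<chi> i. (block_matrix P Q R S *v v) $ Inl i) = P *v u + Q *v w"
    and "(\<chi> i. (block_matrix P Q R S *v v) $ Inr i) = R *v u + S *v w"
  by (simp_all add: vec_eq_iff block_matrix_def matrix_vector_mult_def sum_UNIV_Plus u_def w_def)

text \<open>The off-diagonal block is paid for by both diagonal ones: \<open>P\<close> has a margin
  \<open>d\<close> below the target \<open>b\<close>, and \<open>S\<close> must supply the amount
  that Young's inequality leaves over for this \<open>d\<close>.\<close>

lemma matrix_measure_block_triangular_le:
  fixes P :: "real^'n^'n" and E :: "real^'n^'m" and S :: "real^'m^'m"
  assumes P: "matrix_measure P \<le> b - d"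
    and S: "\<And>w. w \<bullet> (S *v w) \<le> (b - (onorm (\<lambda>u. E *v u))\<^sup>2 / (4 * d)) * (w \<bullet> w)"
    and d: "d > 0"
  shows "matrix_measure (block_matrix P 0 E S) \<le> b"
proof (rule matrix_measure_le)
  fix v :: "real^('n::finite + 'm::finite)"
  define u :: "real^'n" where "u = (\<chi> i. v $ Inl i)"
  define w :: "real^'m" where "w = (\<chi> i. v $ Inr i)"
  define k where "k = onorm (\<lambda>u. E *v u)"
  have uPu: "u \<bullet> (P *v u) \<le> (b - d) * (norm u)\<^sup>2"
    using inner_le_matrix_measure[of u P] mult_right_mono[OF P, of "u \<bullet> u"]
    by (simp add: dot_square_norm)
  have wSw: "w \<bullet> (S *v w) \<le> (b - k\<^sup>2 / (4 * d)) * (norm w)\<^sup>2"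
    using S[of w] by (simp add: k_def dot_square_norm)
  have "w \<bullet> (E *v u) \<le> norm w * norm (E *v u)"
    by (rule norm_cauchy_schwarz)
  also have "\<dots> \<le> norm w * (k * norm u)"
    unfolding k_def by (intro mult_left_mono onorm matrix_vector_mul_bounded_linear) auto
  also have "\<dots> \<le> d * (norm u)\<^sup>2 + k\<^sup>2 / (4 * d) * (norm w)\<^sup>2"
  proof -
    \<comment> \<open>The weight \<open>2 * d\<close> is the one for which the completed square has
      coefficient exactly \<open>d\<close> at \<open>norm u\<close> squared, using up the margin of
      \<open>P\<close>.\<close>
    have "0 \<le> (2 * d * norm u - k * norm w)\<^sup>2 / (4 * d)"
      using d by simp
    also have "\<dots> = d * (norm u)\<^sup>2 + k\<^sup>2 / (4 * d) * (norm w)\<^sup>2 - norm w * (k * norm u)"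
      using d by (simp add: power2_eq_square field_simps)
    finally show ?thesis by simp
  qed
  finally have wEu: "w \<bullet> (E *v u) \<le> d * (norm u)\<^sup>2 + k\<^sup>2 / (4 * d) * (norm w)\<^sup>2" .
  have "v \<bullet> (block_matrix P 0 E S *v v) = u \<bullet> (P *v u) + w \<bullet> (E *v u) + w \<bullet> (S *v w)"
    by (simp add: inner_Plus[of v] block_matrix_vector_mult u_def w_def inner_add_right)
  also have "\<dots> \<le> b * ((norm u)\<^sup>2 + (norm w)\<^sup>2)"
    using uPu wSw wEu by (simp add: algebra_simps)
  also have "(norm u)\<^sup>2 + (norm w)\<^sup>2 = v \<bullet> v"
    by (simp only: inner_Plus[of v v] u_def w_def power2_norm_eq_inner)
  finally show "v \<bullet> (block_matrix P 0 E S *v v) \<le> b * (v \<bullet> v)" .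
qed

text \<open>Taking a multiple of \<open>D\<close> itself as metric for the algebraic variable
  cancels \<open>D\<close> and leaves a scalar block whose size is free.\<close>

lemma mult_matrix_inv_scaleR:
  fixes D :: "real^'m^'m"
  assumes "invertible D" "s \<noteq> 0"
  shows "invertible (s *\<^sub>R D)" "D ** matrix_inv (s *\<^sub>R D) = mat (1 / s)"
proof -
  show inv: "invertible (s *\<^sub>R D)"
    using assms by (simp add: scalar_invertible)
  have "(s *\<^sub>R D) ** matrix_inv (s *\<^sub>R D) = mat 1"
    using inv unfolding invertible_def matrix_inv_def by (rule someI2_ex) simp
  then have "s *\<^sub>R (D ** matrix_inv (s *\<^sub>R D)) = mat 1"
    by (simp add: scalar_matrix_assoc)
  then have "(1 / s) *\<^sub>R s *\<^sub>R (D ** matrix_inv (s *\<^sub>R D)) = (1 / s) *\<^sub>R mat 1"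
    by (rule arg_cong)
  then show "D ** matrix_inv (s *\<^sub>R D) = mat (1 / s)"
    using assms(2) by (simp add: vec_eq_iff mat_def)
qed

lemma transpose_zero: "transpose (0 :: 'a::zero^'n^'m) = 0"
  by (simp add: vec_eq_iff transpose_def)

lemma matrix_mult_zero_left: "(0 :: 'a::semiring_1^'n^'m) ** A = 0"
  by (simp add: vec_eq_iff matrix_matrix_mult_def)

lemma matrix_mult_zero_right: "A ** (0 :: 'a::semiring_1^'n^'m) = 0"
  by (simp add: vec_eq_iff matrix_matrix_mult_def)

lemma mat_vector_mult: "mat c *v w = c *\<^sub>R (w :: real^'m)"
  by (simp add: vec_eq_iff mat_def matrix_vector_mult_def if_distrib if_distribR cong: if_cong)

theorem theorem2:
  fixes f :: "real^'n \<Rightarrow> real^'m \<Rightarrow> real^'n"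
    and g :: "real^'n \<Rightarrow> real^'m \<Rightarrow> real^'m"
    and Y :: "real^'n \<Rightarrow> real^'m"
    and S U :: "(real^'n) set"
    and \<theta> :: "real^'n \<Rightarrow> real \<Rightarrow> real^'n^'n"
  assumes f_C1: "continuously_differentiable (\<lambda>(x, y). f x y)"
    and g_C1: "continuously_differentiable (\<lambda>(x, y). g x y)"
    and branch: "\<And>x. x \<in> S \<Longrightarrow> g x (Y x) = 0"
    and U_subset: "U \<subseteq> regular_domain g Y S"
    and metric: "metric_function_on (regular_domain g Y S) \<theta>"
    and contracting: "\<And>x t. x \<in> U \<Longrightarrow> matrix_measure (reduced_jacobian f g Y \<theta> x t) < 0"
  shows "\<forall>\<epsilon>>0. \<exists>(Q :: real^'n \<Rightarrow> real \<Rightarrow> real^'m^'m)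
            (R :: real^'n \<Rightarrow> real \<Rightarrow> real^'n^'m)
            (\<rho> :: real^'n \<Rightarrow> real \<Rightarrow> real^'m^'m).
          \<forall>x\<in>U. \<forall>t. invertible (\<rho> x t) \<and>
            matrix_measure (unreduced_jacobian f g Y \<theta> (Q x t) (R x t) (\<rho> x t) x t)
              \<le> matrix_measure (reduced_jacobian f g Y \<theta> x t) / (1 + \<epsilon>)"
proof (intro allI impI)
  fix \<epsilon> :: real
  assume \<epsilon>: "\<epsilon> > 0"
  have "\<exists>\<rho>. invertible \<rho> \<and>
      matrix_measure (unreduced_jacobian f g Y \<theta> (mat (- 1)) 0 \<rho> x t)
        \<le> matrix_measure (reduced_jacobian f g Y \<theta> x t) / (1 + \<epsilon>)"
    if x: "x \<in> U" for x t
  proof -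
    define D where "D = D_mat g Y x"
    define E where "E = mat (- 1) ** C_mat g Y x ** matrix_inv (\<theta> x t)"
    define \<mu> where "\<mu> = matrix_measure (reduced_jacobian f g Y \<theta> x t)"
    define b where "b = \<mu> / (1 + \<epsilon>)"
    define d where "d = b - \<mu>"
    \<comment> \<open>This is \<open>1/s\<close> of the overview, set so that
      \<open>- \<kappa>\<close> equals the coefficient demanded of the lower right block.\<close>
    define \<kappa> where "\<kappa> = (onorm (\<lambda>u. E *v u))\<^sup>2 / (4 * d) - b"
    have \<mu>: "\<mu> < 0"
      using contracting[OF x] by (simp add: \<mu>_def)
    have b: "b < 0"
      using \<mu> \<epsilon> by (simp add: b_def divide_neg_pos)
    \<comment> \<open>Dividing the negative \<open>\<mu>\<close> by \<open>1 + \<epsilon>\<close>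
      moves it towards zero: \<open>d = - \<mu> * \<epsilon> / (1 + \<epsilon>)\<close>.\<close>
    have d: "d > 0"
      using \<mu> \<epsilon> by (simp add: d_def b_def field_simps mult_pos_neg)
    have \<kappa>: "\<kappa> > 0"
      using b d by (simp add: \<kappa>_def add_nonneg_pos diff_conv_add_uminus del: add_uminus_conv_diff)
    have "invertible D"
      using U_subset x by (auto simp: D_def regular_domain_def invertible_det_nz)
    then have \<rho>: "invertible ((1 / \<kappa>) *\<^sub>R D)" "D ** matrix_inv ((1 / \<kappa>) *\<^sub>R D) = mat \<kappa>"
      using mult_matrix_inv_scaleR[of D "1 / \<kappa>"] \<kappa> by auto
    \<comment> \<open>The zero \<open>R\<close> clears the upper right block and also leaves the
      reduced Jacobian unperturbed in the upper left one.\<close>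
    have "unreduced_jacobian f g Y \<theta> (mat (- 1)) 0 ((1 / \<kappa>) *\<^sub>R D) x t =
        block_matrix (reduced_jacobian f g Y \<theta> x t) 0 E (mat (- 1) ** mat \<kappa>)"
      by (simp add: unreduced_jacobian_def E_def D_def[symmetric] \<rho>(2) transpose_mat
          matrix_mul_assoc[symmetric] transpose_zero matrix_mult_zero_left
          matrix_mult_zero_right)
    moreover have "matrix_measure \<dots> \<le> b"
    proof (rule matrix_measure_block_triangular_le[OF _ _ d])
      show "matrix_measure (reduced_jacobian f g Y \<theta> x t) \<le> b - d"
        by (simp add: d_def \<mu>_def)
      show "w \<bullet> ((mat (- 1) ** mat \<kappa>) *v w) \<le>
          (b - (onorm (\<lambda>u. E *v u))\<^sup>2 / (4 * d)) * (w \<bullet> w)" for w :: "real^'m"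
        by (simp add: mat_vector_mult matrix_vector_mul_assoc[symmetric] \<kappa>_def algebra_simps)
    qed
    ultimately show ?thesis
      using \<rho>(1) by (auto simp: b_def \<mu>_def)
  qed
  \<comment> \<open>The scale depends on the point and the time through \<open>E\<close> and
    \<open>\<mu>\<close>, so the pointwise metrics are collected into a function by choice.\<close>
  then obtain \<rho> where "\<forall>x\<in>U. \<forall>t. invertible (\<rho> x t) \<and>
      matrix_measure (unreduced_jacobian f g Y \<theta> (mat (- 1)) 0 (\<rho> x t) x t)
        \<le> matrix_measure (reduced_jacobian f g Y \<theta> x t) / (1 + \<epsilon>)"
    by metis
  then show "\<exists>(Q :: real^'n \<Rightarrow> real \<Rightarrow> real^'m^'m)
            (R :: real^'n \<Rightarrow> real \<Rightarrow> real^'n^'m)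
            (\<rho> :: real^'n \<Rightarrow> real \<Rightarrow> real^'m^'m).
          \<forall>x\<in>U. \<forall>t. invertible (\<rho> x t) \<and>
            matrix_measure (unreduced_jacobian f g Y \<theta> (Q x t) (R x t) (\<rho> x t) x t)
              \<le> matrix_measure (reduced_jacobian f g Y \<theta> x t) / (1 + \<epsilon>)"
    by (intro exI[of _ "\<lambda>x t. mat (- 1)"] exI[of _ "\<lambda>x t. 0"] exI[of _ \<rho>])
qed

end
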